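(* Let $\Phi$ be the real affine root system of type $D_{n+1}^{(2)}$, and let $\Psi$ be a maximal closed subroot system of $\Phi$ whose gradient subroot system $\mathrm{Gr}(\Psi)$ is a proper semi-closed subroot system of $\mathring\Phi$. Then there exists a set $I\subsetneq I_n=\{1,\dots,n\}$ such that $\Psi=\Psi_I(D_{n+1}^{(2)})$.
   Context: $n\ge2$; $\epsilon_1,\dots,\epsilon_n$ are orthonormal and $\delta$ is a vector linearly independent of them with $(\delta,\cdot)=0$. $$\Phi=\{\pm\epsilon_i+r\delta,\ \pm\epsilon_i\pm\epsilon_j+2r\delta:r\in\mathbb Z,\ 1\le i\ne j\le n\},\qquad \mathring\Phi=\{\pm\epsilon_i,\pm\epsilon_i\pm\epsilon_j:1\le i\ne j\le n\}$$ (type $B_n$; short roots $\pm\epsilon_i$, long roots $\pm\epsilon_i\pm\epsilon_j$). For $I\subseteq I_n$, $$\Psi_I(D_{n+1}^{(2)})=\{\pm\epsilon_s+2r\delta:s\in I\}\cup\{\pm\epsilon_s+(2r+1)\delta:s\notin I\}\cup\{\pm\epsilon_s\pm\epsilon_t+2r\delta:s\ne t,\ s,t\in I\text{ or }s,t\notin I\},$$ with $r$ ranging over $\mathbb Z$. With $\langle\beta,\alpha^\vee\rangle=2(\beta,\alpha)/(\alpha,\alpha)$ and $\mathbf s_\alpha(\beta)=\beta-\langle\beta,\alpha^\vee\rangle\alpha$, a non-empty subset $\Psi$ of $R$ ($R=\Phi$ or $\mathring\Phi$) is a subroot system if $\mathbf s_\alpha(\beta)\in\Psi$ for all $\alpha,\beta\in\Psi$;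 it is closed if $\alpha,\beta\in\Psi$, $\alpha+\beta\in R$ imply $\alpha+\beta\in\Psi$. A maximal closed subroot system of $R$ is a proper closed subroot system $\Psi$ such that $\Psi\subseteq\Delta\subsetneq R$ with $\Delta$ a closed subroot system implies $\Delta=\Psi$. The gradient is $\mathrm{Gr}(\Psi)=\{\alpha\in\mathring\Phi:\alpha+r\delta\in\Psi\text{ for some }r\}$. A subroot system $\mathring\Psi$ of $\mathring\Phi$ is semi-closed if it is not closed in $\mathring\Phi$ and, whenever $\alpha,\beta\in\mathring\Psi$ satisfy $\alpha+\beta\in\mathring\Phi\setminus\mathring\Psi$, the roots $\alpha,\beta$ are short and $\alpha+\beta$ is long. *)

theory Defs
  imports "HOL-Analysis.Analysis"
begin

text \<open>
  The ambient space is a real vector space with a symmetric bilinear form \<open>B\<close>, which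
  is degenerate (\<open>B \<delta> v = 0\<close>), so it cannot be a \<open>real_inner\<close> structure.
  The vectors \<open>\<epsilon> 1, ..., \<epsilon> n\<close> are the values of \<open>\<epsilon>\<close> on \<open>{1..n}\<close>;
  other values are irrelevant.
\<close>

definition short_roots :: "nat \<Rightarrow> (nat \<Rightarrow> 'a::real_vector) \<Rightarrow> 'a set" where
  "short_roots n \<epsilon> = {a *\<^sub>R \<epsilon> i | a i. a \<in> {1, -1} \<and> i \<in> {1..n}}"

definition long_roots :: "nat \<Rightarrow> (nat \<Rightarrow> 'a::real_vector) \<Rightarrow> 'a set" where
  "long_roots n \<epsilon> = {a *\<^sub>R \<epsilon> i + b *\<^sub>R \<epsilon> j | a b i j.
     a \<in> {1, -1} \<and> b \<in> {1, -1} \<and> i \<in> {1..n} \<and> j \<in> {1..n} \<and> i \<noteq> j}"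

definition finite_roots :: "nat \<Rightarrow> (nat \<Rightarrow> 'a::real_vector) \<Rightarrow> 'a set" where
  "finite_roots n \<epsilon> = short_roots n \<epsilon> \<union> long_roots n \<epsilon>"

definition affine_roots :: "nat \<Rightarrow> (nat \<Rightarrow> 'a::real_vector) \<Rightarrow> 'a \<Rightarrow> 'a set" where
  "affine_roots n \<epsilon> \<delta> =
     {\<alpha> + of_int r *\<^sub>R \<delta> | \<alpha> r. \<alpha> \<in> short_roots n \<epsilon>} \<union>
     {\<alpha> + of_int (2 * r) *\<^sub>R \<delta> | \<alpha> r. \<alpha> \<in> long_roots n \<epsilon>}"

definition Psi_D :: "nat \<Rightarrow> (nat \<Rightarrow> 'a::real_vector) \<Rightarrow> 'a \<Rightarrow> nat set \<Rightarrow> 'a set" where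
  "Psi_D n \<epsilon> \<delta> I =
     {a *\<^sub>R \<epsilon> s + of_int (2 * r) *\<^sub>R \<delta> | a s r.
        a \<in> {1, -1} \<and> s \<in> {1..n} \<and> s \<in> I} \<union>
     {a *\<^sub>R \<epsilon> s + of_int (2 * r + 1) *\<^sub>R \<delta> | a s r.
        a \<in> {1, -1} \<and> s \<in> {1..n} \<and> s \<notin> I} \<union>
     {a *\<^sub>R \<epsilon> s + b *\<^sub>R \<epsilon> t + of_int (2 * r) *\<^sub>R \<delta> | a b s t r.
        a \<in> {1, -1} \<and> b \<in> {1, -1} \<and> s \<in> {1..n} \<and> t \<in> {1..n} \<and> s \<noteq> t \<and>
        (s \<in> I \<and> t \<in> I \<or> s \<notin> I \<and> t \<notin> I)}"

definition coroot_pairing :: "('a \<Rightarrow> 'a \<Rightarrow> real) \<Rightarrow> 'a \<Rightarrow> 'a \<Rightarrow> real" where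
  "coroot_pairing B \<beta> \<alpha> = 2 * B \<beta> \<alpha> / B \<alpha> \<alpha>"

definition root_reflection :: "('a \<Rightarrow> 'a \<Rightarrow> real) \<Rightarrow> 'a \<Rightarrow> 'a \<Rightarrow> 'a::real_vector" where
  "root_reflection B \<alpha> \<beta> = \<beta> - coroot_pairing B \<beta> \<alpha> *\<^sub>R \<alpha>"

definition subroot_system :: "('a \<Rightarrow> 'a \<Rightarrow> real) \<Rightarrow> 'a::real_vector set \<Rightarrow> 'a set \<Rightarrow> bool" where
  "subroot_system B R \<Psi> \<longleftrightarrow>
     \<Psi> \<noteq> {} \<and> \<Psi> \<subseteq> R \<and> (\<forall>\<alpha>\<in>\<Psi>. \<forall>\<beta>\<in>\<Psi>. root_reflection B \<alpha> \<beta> \<in> \<Psi>)"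

definition closed_in_roots :: "'a::real_vector set \<Rightarrow> 'a set \<Rightarrow> bool" where
  "closed_in_roots R \<Psi> \<longleftrightarrow> (\<forall>\<alpha>\<in>\<Psi>. \<forall>\<beta>\<in>\<Psi>. \<alpha> + \<beta> \<in> R \<longrightarrow> \<alpha> + \<beta> \<in> \<Psi>)"

definition closed_subroot_system ::
    "('a \<Rightarrow> 'a \<Rightarrow> real) \<Rightarrow> 'a::real_vector set \<Rightarrow> 'a set \<Rightarrow> bool" where
  "closed_subroot_system B R \<Psi> \<longleftrightarrow> subroot_system B R \<Psi> \<and> closed_in_roots R \<Psi>"

definition maximal_closed_subroot_system ::
    "('a \<Rightarrow> 'a \<Rightarrow> real) \<Rightarrow> 'a::real_vector set \<Rightarrow> 'a set \<Rightarrow> bool" where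
  "maximal_closed_subroot_system B R \<Psi> \<longleftrightarrow>
     closed_subroot_system B R \<Psi> \<and> \<Psi> \<subset> R \<and>
     (\<forall>\<Delta>. closed_subroot_system B R \<Delta> \<and> \<Psi> \<subseteq> \<Delta> \<and> \<Delta> \<subset> R \<longrightarrow> \<Delta> = \<Psi>)"

definition gradient :: "nat \<Rightarrow> (nat \<Rightarrow> 'a::real_vector) \<Rightarrow> 'a \<Rightarrow> 'a set \<Rightarrow> 'a set" where
  "gradient n \<epsilon> \<delta> \<Psi> = {\<alpha> \<in> finite_roots n \<epsilon>. \<exists>r::int. \<alpha> + of_int r *\<^sub>R \<delta> \<in> \<Psi>}"

definition semi_closed ::
    "('a \<Rightarrow> 'a \<Rightarrow> real) \<Rightarrow> nat \<Rightarrow> (nat \<Rightarrow> 'a::real_vector) \<Rightarrow> 'a set \<Rightarrow> bool" where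
  "semi_closed B n \<epsilon> \<Psi> \<longleftrightarrow>
     subroot_system B (finite_roots n \<epsilon>) \<Psi> \<and>
     \<not> closed_in_roots (finite_roots n \<epsilon>) \<Psi> \<and>
     (\<forall>\<alpha>\<in>\<Psi>. \<forall>\<beta>\<in>\<Psi>. \<alpha> + \<beta> \<in> finite_roots n \<epsilon> - \<Psi> \<longrightarrow>
        \<alpha> \<in> short_roots n \<epsilon> \<and> \<beta> \<in> short_roots n \<epsilon> \<and> \<alpha> + \<beta> \<in> long_roots n \<epsilon>)"

end

theory Submission
  imports Defs
begin

text \<open>
  The key is a linear functional. For \<open>I \<subseteq> {1..n}\<close> let \<open>h\<close> send \<open>\<delta>\<close> to 1 and \<open>\<epsilon> k\<close> to 0
  or 1 according to whether \<open>k \<in> I\<close>. Then \<open>Psi_D n \<epsilon> \<delta> I\<close> is exactly the set of affine roots on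
  which \<open>h\<close> is an even integer. Reflections in affine roots permute the affine roots and all coroot
  pairings are integers (\<open>reflection_root\<close>), so by linearity of \<open>h\<close> such a set is a closed subroot
  system; it is proper as soon as \<open>I \<noteq> {1..n}\<close>. By maximality
  of \<open>\<Psi>\<close> it therefore suffices to find one \<open>I \<subset> {1..n}\<close> with \<open>\<Psi> \<subseteq> Psi_D n \<epsilon> \<delta> I\<close>.

  The set \<open>I\<close> is read off from the parities of the \<open>\<delta>\<close>-coefficients of the short roots in
  \<open>\<Psi>\<close>. Semi-closedness provides short roots in directions \<open>\<epsilon> i\<close> and \<open>\<epsilon> j\<close> of the gradient whose
  sum is a root outside the gradient. Short roots of \<open>\<Psi>\<close> in two distinct directions with equal
  parity have a sum that is a root, hence lies in \<open>\<Psi>\<close>; so directions \<open>i\<close> and \<open>j\<close> carry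
  opposite parities. A direction \<open>k\<close> carrying both parities would
  connect \<open>i\<close> to \<open>j\<close>, since \<open>(\<alpha> + \<epsilon> k) + (\<beta> - \<epsilon> k) = \<alpha> + \<beta>\<close>, which is impossible
  (\<open>parity_unique\<close>). One of \<open>i\<close>, \<open>j\<close> carries odd short roots, so the set \<open>I\<close> of directions
  without such roots is a proper subset of \<open>{1..n}\<close>. For this \<open>I\<close> the short
  roots of \<open>\<Psi>\<close> lie in \<open>Psi_D n \<epsilon> \<delta> I\<close>, and the long ones do because subtracting a short root
  from a long one transports its parity from one end to the other (\<open>parity_transport\<close>).
\<close>

locale affine_B_frame =
  fixes n :: nat
    and B :: "'a::real_vector \<Rightarrow> 'a \<Rightarrow> real"
    and \<epsilon> :: "nat \<Rightarrow> 'a"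
    and \<delta> :: 'a
  assumes bilinear: "bilinear B"
    and sym: "B u v = B v u"
    and orthonormal: "i \<in> {1..n} \<Longrightarrow> j \<in> {1..n} \<Longrightarrow> B (\<epsilon> i) (\<epsilon> j) = (if i = j then 1 else 0)"
    and delta_notin_span: "\<delta> \<notin> span (\<epsilon> ` {1..n})"
    and delta_radical: "B \<delta> v = 0"
begin

abbreviation "\<Phi> \<equiv> affine_roots n \<epsilon> \<delta>"

lemmas B_simps = bilinear_ladd[OF bilinear] bilinear_radd[OF bilinear]
  bilinear_lmul[OF bilinear] bilinear_rmul[OF bilinear]
  delta_radical trans[OF sym delta_radical]

lemma short_in_roots:
  "a \<in> {1, -1} \<Longrightarrow> i \<in> {1..n} \<Longrightarrow> a *\<^sub>R \<epsilon> i + of_int r *\<^sub>R \<delta> \<in> \<Phi>"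
  unfolding affine_roots_def short_roots_def by blast

lemma long_in_roots:
  assumes "a \<in> {1, -1}" "b \<in> {1, -1}" "i \<in> {1..n}" "j \<in> {1..n}" "i \<noteq> j" "even r"
  shows "a *\<^sub>R \<epsilon> i + b *\<^sub>R \<epsilon> j + of_int r *\<^sub>R \<delta> \<in> \<Phi>"
proof -
  obtain m where "r = 2 * m" using assms(6) by blast
  then show ?thesis
    using assms(1-5) unfolding affine_roots_def long_roots_def by blast
qed

lemma affine_root_cases:
  assumes "x \<in> \<Phi>"
  obtains (short) a i r where "a \<in> {1, -1}" "i \<in> {1..n}" "x = a *\<^sub>R \<epsilon> i + of_int r *\<^sub>R \<delta>"
  | (long) a b i j r where "a \<in> {1, -1}" "b \<in> {1, -1}" "i \<in> {1..n}" "j \<in> {1..n}" "i \<noteq> j"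
      "x = a *\<^sub>R \<epsilon> i + b *\<^sub>R \<epsilon> j + of_int (2 * r) *\<^sub>R \<delta>"
  using assms unfolding affine_roots_def short_roots_def long_roots_def by blast

section \<open>Reflections of affine roots\<close>

lemma root_norm_nonzero:
  assumes "x \<in> \<Phi>" shows "B x x \<noteq> 0"
  using assms by (cases rule: affine_root_cases) (auto simp: B_simps orthonormal)

lemma reflection_self:
  assumes "x \<in> \<Phi>" shows "root_reflection B x x = - x"
proof -
  have "coroot_pairing B x x = 2"
    using root_norm_nonzero[OF assms] by (simp add: coroot_pairing_def)
  then show ?thesis
    by (simp add: root_reflection_def scaleR_2)
qed

lemma pairing_add: "coroot_pairing B (x + y) \<alpha> = coroot_pairing B x \<alpha> + coroot_pairing B y \<alpha>"
  by (simp add: coroot_pairing_def B_simps add_divide_distrib distrib_left)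

lemma reflection_add: "root_reflection B \<alpha> (x + y) = root_reflection B \<alpha> x + root_reflection B \<alpha> y"
  by (simp add: root_reflection_def pairing_add algebra_simps)

lemma reflection_isometry:
  assumes "B \<alpha> \<alpha> \<noteq> 0"
  shows "B (root_reflection B \<alpha> x) (root_reflection B \<alpha> y) = B x y"
  using assms sym[of \<alpha> y]
  by (simp add: root_reflection_def coroot_pairing_def B_simps bilinear_lsub[OF bilinear]
      bilinear_rsub[OF bilinear] field_simps)

text \<open>
  A short root can move under a reflection only by an even multiple of \<open>\<delta>\<close>: the pairing with a
  short \<open>\<alpha>\<close> is even, and a long \<open>\<alpha>\<close> has itself an even \<open>\<delta>\<close>-coefficient.
\<close>
lemma reflection_short:
  assumes "\<alpha> \<in> \<Phi>" "c \<in> {1, -1}" "k \<in> {1..n}"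
  obtains d l t m where "d \<in> {1, -1}" "l \<in> {1..n}"
    "root_reflection B \<alpha> (c *\<^sub>R \<epsilon> k + of_int s *\<^sub>R \<delta>) = d *\<^sub>R \<epsilon> l + of_int (s + 2 * t) *\<^sub>R \<delta>"
    "coroot_pairing B (c *\<^sub>R \<epsilon> k + of_int s *\<^sub>R \<delta>) \<alpha> = of_int m"
  using assms(1)
proof (cases rule: affine_root_cases)
  case (short a i r)
  show thesis
  proof (cases "k = i")
    case True
    have p: "coroot_pairing B (c *\<^sub>R \<epsilon> k + of_int s *\<^sub>R \<delta>) \<alpha> = 2 * (c * a)"
      using short assms True by (auto simp: coroot_pairing_def B_simps orthonormal)
    show thesis
      using short assms True p
      by (intro that[of "-c" k "if c = a then - r else r" "if c = a then 2 else -2"])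
        (auto simp: root_reflection_def algebra_simps scaleR_2)
  next
    case False
    have p: "coroot_pairing B (c *\<^sub>R \<epsilon> k + of_int s *\<^sub>R \<delta>) \<alpha> = 0"
      using short assms False by (auto simp: coroot_pairing_def B_simps orthonormal)
    show thesis
      using assms p by (intro that[of c k 0 0]) (auto simp: root_reflection_def)
  qed
next
  note result = that
  case (long a b i j r)
  have *: thesis
    if "\<alpha> = a *\<^sub>R \<epsilon> k + b *\<^sub>R \<epsilon> j + of_int (2 * r) *\<^sub>R \<delta>" "j \<noteq> k" "j \<in> {1..n}"
      "a \<in> {1, -1}" "b \<in> {1, -1}" for a b j
  proof -
    have p: "coroot_pairing B (c *\<^sub>R \<epsilon> k + of_int s *\<^sub>R \<delta>) \<alpha> = c * a"
      using that assms by (auto simp: coroot_pairing_def B_simps orthonormal)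
    have "root_reflection B \<alpha> (c *\<^sub>R \<epsilon> k + of_int s *\<^sub>R \<delta>) =
        - (c * a * b) *\<^sub>R \<epsilon> j + of_int (s + 2 * (if c = a then - r else r)) *\<^sub>R \<delta>"
      unfolding root_reflection_def p unfolding that(1)
      using assms(2) that(4,5) by (auto simp: algebra_simps)
    moreover have "- (c * a * b) \<in> {1, -1}"
      using assms(2) that(4,5) by auto
    moreover have "coroot_pairing B (c *\<^sub>R \<epsilon> k + of_int s *\<^sub>R \<delta>) \<alpha> =
        of_int (if c = a then 1 else -1)"
      unfolding p using assms(2) that(4) by auto
    ultimately show thesis using result that(3) by blast
  qed
  consider "k = i" | "k = j" | "k \<noteq> i" "k \<noteq> j" by blast
  then show thesis
  proof cases
    case 1
    then show thesis using *[of a b j] long by auto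
  next
    case 2
    then show thesis using *[of b a i] long by (auto simp: add.commute)
  next
    case 3
    then have p: "coroot_pairing B (c *\<^sub>R \<epsilon> k + of_int s *\<^sub>R \<delta>) \<alpha> = 0"
      using long assms by (auto simp: coroot_pairing_def B_simps orthonormal)
    show thesis
      using assms p by (intro that[of c k 0 0]) (auto simp: root_reflection_def)
  qed
qed

text \<open>
  A long root is a sum of two orthogonal short roots with even total \<open>\<delta>\<close>-coefficient, so the
  general case reduces to short roots by additivity and isometry of reflections.
\<close>
lemma reflection_root:
  assumes "\<alpha> \<in> \<Phi>" "\<beta> \<in> \<Phi>"
  shows "root_reflection B \<alpha> \<beta> \<in> \<Phi> \<and> (\<exists>m::int. coroot_pairing B \<beta> \<alpha> = of_int m)"
  using assms(2)
proof (cases rule: affine_root_cases)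
  case (short c k s)
  then show ?thesis
    using reflection_short[OF assms(1) short(1,2), of s] short_in_roots by metis
next
  case (long a b i j r)
  define x where "x = a *\<^sub>R \<epsilon> i + of_int (2 * r) *\<^sub>R \<delta>"
  define y where "y = b *\<^sub>R \<epsilon> j + of_int 0 *\<^sub>R \<delta>"
  have xy: "\<beta> = x + y" using long by (simp add: x_def y_def)
  obtain c k t m where x': "c \<in> {1, -1}" "k \<in> {1..n}"
    "root_reflection B \<alpha> x = c *\<^sub>R \<epsilon> k + of_int (2 * r + 2 * t) *\<^sub>R \<delta>"
    "coroot_pairing B x \<alpha> = of_int m"
    using reflection_short[OF assms(1) long(1,3), of "2 * r"] unfolding x_def by blast
  obtain d l u q where y': "d \<in> {1, -1}" "l \<in> {1..n}"
    "root_reflection B \<alpha> y = d *\<^sub>R \<epsilon> l + of_int (0 + 2 * u) *\<^sub>R \<delta>"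
    "coroot_pairing B y \<alpha> = of_int q"
    using reflection_short[OF assms(1) long(2,4), of 0] unfolding y_def by blast
  have "B (root_reflection B \<alpha> x) (root_reflection B \<alpha> y) = B x y"
    by (rule reflection_isometry[OF root_norm_nonzero[OF assms(1)]])
  also have "\<dots> = 0"
    using long by (simp add: x_def y_def B_simps orthonormal)
  finally have "k \<noteq> l"
    using x'(1,2) y'(1,2) unfolding x'(3) y'(3) by (auto simp: B_simps orthonormal)
  then have "c *\<^sub>R \<epsilon> k + d *\<^sub>R \<epsilon> l + of_int (2 * r + 2 * t + 2 * u) *\<^sub>R \<delta> \<in> \<Phi>"
    using x'(1,2) y'(1,2) by (intro long_in_roots) auto
  moreover have "root_reflection B \<alpha> \<beta> =
      c *\<^sub>R \<epsilon> k + d *\<^sub>R \<epsilon> l + of_int (2 * r + 2 * t + 2 * u) *\<^sub>R \<delta>"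
    by (simp add: xy reflection_add x'(3) y'(3) algebra_simps)
  ultimately have "root_reflection B \<alpha> \<beta> \<in> \<Phi>" by (simp only:)
  moreover have "coroot_pairing B \<beta> \<alpha> = of_int (m + q)"
    by (simp add: xy pairing_add x'(4) y'(4))
  ultimately show ?thesis by blast
qed

section \<open>The closed subroot systems attached to index sets\<close>

text \<open>
  The \<open>\<delta>\<close>-coefficient is extended from an independent spanning subset of the \<open>\<epsilon> k\<close> together with
  \<open>\<delta>\<close>; the coordinates outside \<open>I\<close> are read off with the form.
\<close>
lemma parity_functional:
  obtains h :: "'a \<Rightarrow> real" where "linear h" "h \<delta> = 1"
    "\<And>k. k \<in> {1..n} \<Longrightarrow> h (\<epsilon> k) = (if k \<in> I then 0 else 1)"
proof -
  obtain C where C: "C \<subseteq> \<epsilon> ` {1..n}" "independent C" "\<epsilon> ` {1..n} \<subseteq> span C"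
    using maximal_independent_subset by blast
  have "span C \<subseteq> span (\<epsilon> ` {1..n})" using C(1) by (rule span_mono)
  then have "\<delta> \<notin> span C" using delta_notin_span by blast
  then have "independent (insert \<delta> C)" "\<delta> \<notin> C"
    using C(2) by (auto simp: independent_insert span_base)
  then obtain f :: "'a \<Rightarrow> real" where f: "linear f" "\<forall>x\<in>insert \<delta> C. f x = (if x = \<delta> then 1 else 0)"
    using linear_independent_extend[of "insert \<delta> C" "\<lambda>x. if x = \<delta> then 1 else 0"] by blast
  have f0: "f (\<epsilon> k) = 0" if "k \<in> {1..n}" for k
  proof (rule linear_eq_0_on_span[OF f(1)])
    show "\<epsilon> k \<in> span C" using C(3) that by blast
    show "f x = 0" if "x \<in> C" for x using f(2) that \<open>\<delta> \<notin> C\<close> by auto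
  qed
  define h where "h v = f v + (\<Sum>k\<in>{1..n} - I. B v (\<epsilon> k))" for v
  have "linear h"
    unfolding h_def
    by (intro linear_compose_add f(1) linear_compose_sum ballI) (use bilinear in \<open>auto simp: bilinear_def\<close>)
  moreover have "h \<delta> = 1" using f(2) by (simp add: h_def delta_radical)
  moreover have "h (\<epsilon> k) = (if k \<in> I then 0 else 1)" if k: "k \<in> {1..n}" for k
  proof -
    have "(\<Sum>j\<in>{1..n} - I. B (\<epsilon> k) (\<epsilon> j)) = (\<Sum>j\<in>{1..n} - I. if k = j then 1 else 0)"
      by (rule sum.cong) (use k orthonormal in auto)
    also have "\<dots> = (if k \<in> I then 0 else 1)" using k by (simp add: sum.delta)
    finally show ?thesis using f0[OF k] by (simp add: h_def)
  qed
  ultimately show thesis by (rule that)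
qed

lemma of_int_eq_double_iff:
  "(real_of_int r = 2 * real_of_int m) \<longleftrightarrow> r = 2 * m"
  by (metis of_int_eq_iff of_int_mult of_int_numeral)

lemma Psi_D_cases:
  assumes "x \<in> Psi_D n \<epsilon> \<delta> I"
  obtains
    (short_in) a s r where "a \<in> {1, -1}" "s \<in> {1..n}" "s \<in> I"
      "x = a *\<^sub>R \<epsilon> s + of_int (2 * r) *\<^sub>R \<delta>"
  | (short_out) a s r where "a \<in> {1, -1}" "s \<in> {1..n}" "s \<notin> I"
      "x = a *\<^sub>R \<epsilon> s + of_int (2 * r + 1) *\<^sub>R \<delta>"
  | (long) a b s t r where "a \<in> {1, -1}" "b \<in> {1, -1}" "s \<in> {1..n}" "t \<in> {1..n}" "s \<noteq> t"
      "s \<in> I \<and> t \<in> I \<or> s \<notin> I \<and> t \<notin> I"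
      "x = a *\<^sub>R \<epsilon> s + b *\<^sub>R \<epsilon> t + of_int (2 * r) *\<^sub>R \<delta>"
  using assms unfolding Psi_D_def
proof (elim UnE CollectE exE conjE, goal_cases)
  case 1 show thesis by (rule short_in) (fact 1)+
next
  case 2 show thesis by (rule short_out) (fact 2)+
next
  case 3 show thesis by (rule long[rotated 6]) (fact 3)+
qed

text \<open>
  This description turns all closure properties of \<open>Psi_D\<close> into arithmetic of even integers.
\<close>
lemma Psi_D_eq_even_roots:
  fixes h :: "'a \<Rightarrow> real"
  assumes h: "linear h" "h \<delta> = 1"
    "\<And>k. k \<in> {1..n} \<Longrightarrow> h (\<epsilon> k) = (if k \<in> I then 0 else 1)"
  shows "Psi_D n \<epsilon> \<delta> I = {x \<in> \<Phi>. \<exists>m::int. h x = of_int (2 * m)}"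
proof (intro set_eqI iffI)
  have [simp]: "h (x + y) = h x + h y" "h (c *\<^sub>R x) = c * h x" for x y c
    by (simp_all add: linear_add[OF h(1)] linear_cmul[OF h(1)])
  fix x
  {
    assume "x \<in> Psi_D n \<epsilon> \<delta> I"
    then show "x \<in> {x \<in> \<Phi>. \<exists>m::int. h x = of_int (2 * m)}"
    proof (cases rule: Psi_D_cases)
      case (short_in a s r)
      then show ?thesis
        using short_in_roots[of a s "2 * r"] by (auto simp: h intro!: exI[of _ r])
    next
      case (short_out a s r)
      then show ?thesis
        using short_in_roots[of a s "2 * r + 1"]
        by (auto simp: h intro!: exI[of _ "if a = 1 then r + 1 else r"])
    next
      case (long a b s t r)
      have "x \<in> \<Phi>" using long long_in_roots[of a b s t "2 * r"] by auto
      moreover have "h x = of_int (2 * (r + (if s \<in> I \<or> a \<noteq> b then 0 else if a = 1 then 1 else -1)))"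
        using long by (auto simp: h)
      ultimately show ?thesis by blast
    qed
  }
  assume "x \<in> {x \<in> \<Phi>. \<exists>m::int. h x = of_int (2 * m)}"
  then obtain m where x: "x \<in> \<Phi>" and m: "h x = of_int (2 * m)" by blast
  from x show "x \<in> Psi_D n \<epsilon> \<delta> I"
  proof (cases rule: affine_root_cases)
    case (short a i r)
    show ?thesis
    proof (cases "i \<in> I")
      case True
      then have "r = 2 * m" using m short by (simp add: h of_int_eq_double_iff)
      then show ?thesis using short True unfolding Psi_D_def by blast
    next
      case False
      then have "real_of_int r = of_int (2 * m) - a" using m short by (simp add: h)
      also have "\<dots> = of_int (2 * (if a = 1 then m - 1 else m) + 1)" using short by auto
      finally have "r = 2 * (if a = 1 then m - 1 else m) + 1" by (simp only: of_int_eq_iff)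
      then show ?thesis using short False unfolding Psi_D_def by blast
    qed
  next
    case (long a b i j r)
    have "i \<in> I \<longleftrightarrow> j \<in> I"
    proof (rule ccontr)
      assume "(i \<in> I) \<noteq> (j \<in> I)"
      then obtain e where "e \<in> {1, -1}" "e = real_of_int (2 * (m - r))"
        using m long by (auto simp: h split: if_splits)
      then have "real_of_int (2 * (m - r)) = of_int 1 \<or> real_of_int (2 * (m - r)) = of_int (-1)"
        by auto
      then have "2 * (m - r) = 1 \<or> 2 * (m - r) = -1" by (simp only: of_int_eq_iff)
      then show False by presburger
    qed
    then show ?thesis using long unfolding Psi_D_def by blast
  qed
qed

lemma Psi_D_closed_subroot_system:
  assumes "n \<ge> 1"
  shows "closed_subroot_system B \<Phi> (Psi_D n \<epsilon> \<delta> I)"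
proof -
  obtain h :: "'a \<Rightarrow> real" where h: "linear h" "h \<delta> = 1"
    "\<And>k. k \<in> {1..n} \<Longrightarrow> h (\<epsilon> k) = (if k \<in> I then 0 else 1)"
    using parity_functional[of I] by blast
  have eq: "Psi_D n \<epsilon> \<delta> I = {x \<in> \<Phi>. \<exists>m::int. h x = of_int (2 * m)}"
    using h by (rule Psi_D_eq_even_roots)
  have "Psi_D n \<epsilon> \<delta> I \<noteq> {}"
  proof -
    have "1 \<in> {1..n}" using assms by simp
    then show ?thesis unfolding Psi_D_def by (cases "1 \<in> I") blast+
  qed
  moreover have "root_reflection B \<alpha> \<beta> \<in> Psi_D n \<epsilon> \<delta> I"
    if ab: "\<alpha> \<in> Psi_D n \<epsilon> \<delta> I" "\<beta> \<in> Psi_D n \<epsilon> \<delta> I" for \<alpha> \<beta>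
  proof -
    obtain p q where pq: "\<alpha> \<in> \<Phi>" "h \<alpha> = of_int (2 * p)" "\<beta> \<in> \<Phi>" "h \<beta> = of_int (2 * q)"
      using ab unfolding eq by blast
    obtain m where m: "coroot_pairing B \<beta> \<alpha> = of_int m"
      using reflection_root[OF pq(1,3)] by blast
    have "h (root_reflection B \<alpha> \<beta>) = of_int (2 * (q - m * p))"
      by (simp add: root_reflection_def m linear_diff[OF h(1)] linear_cmul[OF h(1)] pq)
    then show ?thesis unfolding eq using reflection_root[OF pq(1,3)] by blast
  qed
  moreover have "\<alpha> + \<beta> \<in> Psi_D n \<epsilon> \<delta> I"
    if ab: "\<alpha> \<in> Psi_D n \<epsilon> \<delta> I" "\<beta> \<in> Psi_D n \<epsilon> \<delta> I" "\<alpha> + \<beta> \<in> \<Phi>" for \<alpha> \<beta>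
  proof -
    obtain p q where pq: "h \<alpha> = of_int (2 * p)" "h \<beta> = of_int (2 * q)"
      using ab unfolding eq by blast
    have "h (\<alpha> + \<beta>) = of_int (2 * (p + q))"
      by (simp add: linear_add[OF h(1)] pq)
    then show ?thesis unfolding eq using ab(3) by blast
  qed
  moreover have "Psi_D n \<epsilon> \<delta> I \<subseteq> \<Phi>" unfolding eq by blast
  ultimately show ?thesis
    unfolding closed_subroot_system_def subroot_system_def closed_in_roots_def by blast
qed

lemma Psi_D_proper:
  assumes "I \<subset> {1..n}"
  shows "Psi_D n \<epsilon> \<delta> I \<subset> \<Phi>"
proof -
  obtain h :: "'a \<Rightarrow> real" where h: "linear h" "h \<delta> = 1"
    "\<And>k. k \<in> {1..n} \<Longrightarrow> h (\<epsilon> k) = (if k \<in> I then 0 else 1)"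
    using parity_functional[of I] by blast
  have eq: "Psi_D n \<epsilon> \<delta> I = {x \<in> \<Phi>. \<exists>m::int. h x = of_int (2 * m)}"
    using h by (rule Psi_D_eq_even_roots)
  obtain k where k: "k \<in> {1..n}" "k \<notin> I" using assms by blast
  have "\<epsilon> k \<in> \<Phi>" using short_in_roots[of 1 k 0] k by simp
  moreover have "\<epsilon> k \<notin> Psi_D n \<epsilon> \<delta> I"
  proof
    assume "\<epsilon> k \<in> Psi_D n \<epsilon> \<delta> I"
    then obtain m where "h (\<epsilon> k) = of_int (2 * m)" unfolding eq by blast
    then have "real_of_int (2 * m) = of_int 1" using h(3)[OF k(1)] k by simp
    then have "2 * m = 1" by (simp only: of_int_eq_iff)
    then show False by presburger
  qed
  ultimately show ?thesis unfolding eq by blast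
qed

end

section \<open>Parities of short roots in a closed subroot system\<close>

locale closed_affine_subsystem = affine_B_frame +
  fixes \<Psi> :: "'a::real_vector set"
  assumes closed: "closed_subroot_system B (affine_roots n \<epsilon> \<delta>) \<Psi>"
begin

lemma subset_roots: "\<Psi> \<subseteq> \<Phi>"
  using closed by (simp add: closed_subroot_system_def subroot_system_def)

lemma add_closed: "x \<in> \<Psi> \<Longrightarrow> y \<in> \<Psi> \<Longrightarrow> x + y \<in> \<Phi> \<Longrightarrow> x + y \<in> \<Psi>"
  using closed by (simp add: closed_subroot_system_def closed_in_roots_def)

lemma neg_closed:
  assumes "x \<in> \<Psi>" shows "- x \<in> \<Psi>"
proof -
  have "root_reflection B x x \<in> \<Psi>"
    using closed assms by (simp add: closed_subroot_system_def subroot_system_def)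
  then show ?thesis using reflection_self[of x] assms subset_roots by auto
qed

text \<open>
  Only the sign \<open>+\<close> is recorded: negation preserves \<open>\<Psi>\<close> and the parity of the \<open>\<delta>\<close>-coefficient.
\<close>
definition has_parity :: "bool \<Rightarrow> nat \<Rightarrow> bool" where
  "has_parity p k \<longleftrightarrow> (\<exists>r::int. even r = p \<and> \<epsilon> k + of_int r *\<^sub>R \<delta> \<in> \<Psi>)"

lemma has_parityD:
  assumes "has_parity p k" "a \<in> {1, -1}"
  shows "\<exists>r::int. even r = p \<and> a *\<^sub>R \<epsilon> k + of_int r *\<^sub>R \<delta> \<in> \<Psi>"
proof -
  obtain r :: int where r: "even r = p" "\<epsilon> k + of_int r *\<^sub>R \<delta> \<in> \<Psi>"
    using assms(1) unfolding has_parity_def by blast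
  have "(-1) *\<^sub>R \<epsilon> k + of_int (- r) *\<^sub>R \<delta> \<in> \<Psi>" using neg_closed[OF r(2)] by simp
  moreover have "1 *\<^sub>R \<epsilon> k + of_int r *\<^sub>R \<delta> \<in> \<Psi>" using r(2) by simp
  ultimately show ?thesis using assms(2) r(1)
    by (metis even_minus empty_iff insert_iff)
qed

lemma has_parityI:
  assumes "a *\<^sub>R \<epsilon> k + of_int r *\<^sub>R \<delta> \<in> \<Psi>" "a \<in> {1, -1}"
  shows "has_parity (even r) k"
proof (cases "a = 1")
  case True
  then show ?thesis using assms(1) unfolding has_parity_def by auto
next
  case False
  then have "\<epsilon> k + of_int (- r) *\<^sub>R \<delta> \<in> \<Psi>"
    using neg_closed[OF assms(1)] assms(2) by simp
  then show ?thesis unfolding has_parity_def by (metis even_minus)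
qed

lemma equal_parity_link:
  assumes "has_parity p k" "has_parity p l" "k \<noteq> l" "k \<in> {1..n}" "l \<in> {1..n}"
    and ab: "a \<in> {1, -1}" "b \<in> {1, -1}"
  shows "\<exists>r::int. even r \<and> a *\<^sub>R \<epsilon> k + b *\<^sub>R \<epsilon> l + of_int r *\<^sub>R \<delta> \<in> \<Psi>"
proof -
  obtain r where r: "even r = p" "a *\<^sub>R \<epsilon> k + of_int r *\<^sub>R \<delta> \<in> \<Psi>"
    using has_parityD assms(1) ab(1) by blast
  obtain s where s: "even s = p" "b *\<^sub>R \<epsilon> l + of_int s *\<^sub>R \<delta> \<in> \<Psi>"
    using has_parityD assms(2) ab(2) by blast
  have eq: "(a *\<^sub>R \<epsilon> k + of_int r *\<^sub>R \<delta>) + (b *\<^sub>R \<epsilon> l + of_int s *\<^sub>R \<delta>) =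
      a *\<^sub>R \<epsilon> k + b *\<^sub>R \<epsilon> l + of_int (r + s) *\<^sub>R \<delta>"
    by (simp add: algebra_simps)
  have ev: "even (r + s)" using r(1) s(1) by simp
  show ?thesis
    using add_closed[OF r(2) s(2)] long_in_roots[OF ab assms(4,5,3) ev] ev unfolding eq by blast
qed

text \<open>
  The assumption \<open>unlinked\<close> is what failure of closedness of the gradient amounts to. A direction
  carrying both parities would be linked to both \<open>i\<close> and \<open>j\<close>, and adding the two links
  eliminates that direction.
\<close>
lemma parity_unique:
  assumes ij: "i \<in> {1..n}" "j \<in> {1..n}" "i \<noteq> j" "has_parity p i" "has_parity q j"
    and ab: "a \<in> {1, -1}" "b \<in> {1, -1}"
    and unlinked: "\<And>r::int. a *\<^sub>R \<epsilon> i + b *\<^sub>R \<epsilon> j + of_int r *\<^sub>R \<delta> \<notin> \<Psi>"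
    and k: "k \<in> {1..n}"
  shows "\<not> (has_parity True k \<and> has_parity False k)"
proof
  assume both: "has_parity True k \<and> has_parity False k"
  then have any: "has_parity s k" for s by (cases s) auto
  have no: "\<not> (has_parity s i \<and> has_parity s j)" for s
    using equal_parity_link[of s i j a b] ij ab unlinked by blast
  have "k \<noteq> i" "k \<noteq> j" using no any ij by metis+
  obtain r where r: "even r" "a *\<^sub>R \<epsilon> i + 1 *\<^sub>R \<epsilon> k + of_int r *\<^sub>R \<delta> \<in> \<Psi>"
    using equal_parity_link[OF ij(4) any \<open>k \<noteq> i\<close>[symmetric] ij(1) k ab(1), of 1] by auto
  obtain s where s: "even s" "b *\<^sub>R \<epsilon> j + (-1) *\<^sub>R \<epsilon> k + of_int s *\<^sub>R \<delta> \<in> \<Psi>"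
    using equal_parity_link[OF ij(5) any \<open>k \<noteq> j\<close>[symmetric] ij(2) k ab(2), of "-1"] by auto
  have eq: "(a *\<^sub>R \<epsilon> i + 1 *\<^sub>R \<epsilon> k + of_int r *\<^sub>R \<delta>) + (b *\<^sub>R \<epsilon> j + (-1) *\<^sub>R \<epsilon> k + of_int s *\<^sub>R \<delta>) =
      a *\<^sub>R \<epsilon> i + b *\<^sub>R \<epsilon> j + of_int (r + s) *\<^sub>R \<delta>"
    by (simp add: algebra_simps)
  have "even (r + s)" using r s by simp
  from add_closed[OF r(2) s(2)] long_in_roots[OF ab ij(1-3) this] unlinked[of "r + s"]
  show False unfolding eq by blast
qed

text \<open>
  Subtracting a short root in direction \<open>k\<close> from the long root leaves a short root in direction
  \<open>l\<close>, and the \<open>\<delta>\<close>-coefficient of the long root is even.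
\<close>
lemma parity_transport:
  assumes long: "a *\<^sub>R \<epsilon> k + b *\<^sub>R \<epsilon> l + of_int (2 * r) *\<^sub>R \<delta> \<in> \<Psi>"
    and "a \<in> {1, -1}" "b \<in> {1, -1}" "l \<in> {1..n}" "has_parity p k"
  shows "has_parity p l"
proof -
  have "- a \<in> {1, -1}" using assms(2) by auto
  then obtain s where s: "even s = p" "(- a) *\<^sub>R \<epsilon> k + of_int s *\<^sub>R \<delta> \<in> \<Psi>"
    using has_parityD[OF assms(5)] by blast
  have eq: "((- a) *\<^sub>R \<epsilon> k + of_int s *\<^sub>R \<delta>) + (a *\<^sub>R \<epsilon> k + b *\<^sub>R \<epsilon> l + of_int (2 * r) *\<^sub>R \<delta>) =
      b *\<^sub>R \<epsilon> l + of_int (s + 2 * r) *\<^sub>R \<delta>"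
    by (simp add: algebra_simps)
  have "b *\<^sub>R \<epsilon> l + of_int (s + 2 * r) *\<^sub>R \<delta> \<in> \<Psi>"
    using add_closed[OF s(2) long] short_in_roots[OF assms(3,4)] unfolding eq by blast
  from has_parityI[OF this assms(3)] show ?thesis using s(1) by simp
qed

text \<open>
  Directions without short roots in \<open>\<Psi>\<close> are put into \<open>I\<close> as well; they are harmless because no
  long root of \<open>\<Psi>\<close> joins them to a direction that does carry short roots.
\<close>
lemma subset_Psi_D:
  assumes unique: "\<And>k. k \<in> {1..n} \<Longrightarrow> \<not> (has_parity True k \<and> has_parity False k)"
  shows "\<Psi> \<subseteq> Psi_D n \<epsilon> \<delta> {k \<in> {1..n}. \<not> has_parity False k}"
    (is "_ \<subseteq> Psi_D n \<epsilon> \<delta> ?I")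
proof
  fix x assume x: "x \<in> \<Psi>"
  then have "x \<in> \<Phi>" using subset_roots by blast
  then show "x \<in> Psi_D n \<epsilon> \<delta> ?I"
  proof (cases rule: affine_root_cases)
    case (short a i r)
    have par: "has_parity (even r) i" using has_parityI[of a i r] x short by auto
    show ?thesis
    proof (cases "even r")
      case True
      then have "i \<in> ?I" using par unique short(2) by auto
      moreover obtain m where "r = 2 * m" using True by blast
      ultimately show ?thesis using short unfolding Psi_D_def by blast
    next
      case False
      then have "i \<notin> ?I" using par by simp
      moreover obtain m where "r = 2 * m + 1" using False oddE by blast
      ultimately show ?thesis using short unfolding Psi_D_def by blast
    qed
  next
    case (long a b i j r)
    have "has_parity False i \<Longrightarrow> has_parity False j"
      using parity_transport[of a i b j r False] x long by auto
    moreover have "has_parity False j \<Longrightarrow> has_parity False i"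
      using parity_transport[of b j a i r False] x long by (auto simp: add.commute)
    ultimately have "i \<in> ?I \<and> j \<in> ?I \<or> i \<notin> ?I \<and> j \<notin> ?I" using long by auto
    then show ?thesis using long unfolding Psi_D_def by blast
  qed
qed

end

section \<open>The classification\<close>

theorem proposition6p1p3:
  fixes n :: nat
    and B :: "'a::real_vector \<Rightarrow> 'a \<Rightarrow> real"
    and \<epsilon> :: "nat \<Rightarrow> 'a"
    and \<delta> :: 'a
    and \<Psi> :: "'a set"
  assumes "n \<ge> 2"
    and "bilinear B"
    and "\<And>u v. B u v = B v u"
    and "\<And>i j. i \<in> {1..n} \<Longrightarrow> j \<in> {1..n} \<Longrightarrow> B (\<epsilon> i) (\<epsilon> j) = (if i = j then 1 else 0)"
    and "\<delta> \<notin> span (\<epsilon> ` {1..n})"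
    and "\<And>v. B \<delta> v = 0"
    and "maximal_closed_subroot_system B (affine_roots n \<epsilon> \<delta>) \<Psi>"
    and "gradient n \<epsilon> \<delta> \<Psi> \<subset> finite_roots n \<epsilon>"
    and "semi_closed B n \<epsilon> (gradient n \<epsilon> \<delta> \<Psi>)"
  shows "\<exists>I. I \<subset> {1..n} \<and> \<Psi> = Psi_D n \<epsilon> \<delta> I"
proof -
  have cl: "closed_subroot_system B (affine_roots n \<epsilon> \<delta>) \<Psi>"
    and maximal: "\<And>\<Delta>. closed_subroot_system B (affine_roots n \<epsilon> \<delta>) \<Delta> \<Longrightarrow> \<Psi> \<subseteq> \<Delta> \<Longrightarrow>
      \<Delta> \<subset> affine_roots n \<epsilon> \<delta> \<Longrightarrow> \<Delta> = \<Psi>"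
    using assms(7) unfolding maximal_closed_subroot_system_def by blast+
  interpret closed_affine_subsystem n B \<epsilon> \<delta> \<Psi>
    by unfold_locales (fact assms(2-6) cl)+
  let ?G = "gradient n \<epsilon> \<delta> \<Psi>"
  obtain \<alpha> \<beta> where \<alpha>\<beta>: "\<alpha> \<in> ?G" "\<beta> \<in> ?G" "\<alpha> + \<beta> \<in> finite_roots n \<epsilon> - ?G"
    using assms(9) unfolding semi_closed_def closed_in_roots_def by blast
  then have sh: "\<alpha> \<in> short_roots n \<epsilon>" "\<beta> \<in> short_roots n \<epsilon>" "\<alpha> + \<beta> \<in> long_roots n \<epsilon>"
    using assms(9) unfolding semi_closed_def by blast+
  obtain a i where ai: "a \<in> {1, -1}" "i \<in> {1..n}" "\<alpha> = a *\<^sub>R \<epsilon> i"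
    using sh(1) unfolding short_roots_def by blast
  obtain b j where bj: "b \<in> {1, -1}" "j \<in> {1..n}" "\<beta> = b *\<^sub>R \<epsilon> j"
    using sh(2) unfolding short_roots_def by blast
  \<comment> \<open>A multiple of a single \<open>\<epsilon> i\<close> obtained here has norm 0 or 4, whereas long roots have norm 2.\<close>
  have "i \<noteq> j"
  proof
    assume "i = j"
    obtain c d k l where cd: "c \<in> {1, -1}" "d \<in> {1, -1}" "k \<in> {1..n}" "l \<in> {1..n}" "k \<noteq> l"
      "\<alpha> + \<beta> = c *\<^sub>R \<epsilon> k + d *\<^sub>R \<epsilon> l"
      using sh(3) unfolding long_roots_def by blast
    have "B (\<alpha> + \<beta>) (\<alpha> + \<beta>) = 2"
      unfolding cd(6) using cd(1-5) by (auto simp: B_simps orthonormal)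
    moreover have "B (\<alpha> + \<beta>) (\<alpha> + \<beta>) \<in> {0, 4}"
      unfolding ai(3) bj(3) using ai(1,2) bj(1,2) \<open>i = j\<close> by (auto simp: B_simps orthonormal)
    ultimately show False by auto
  qed
  have unlinked: "a *\<^sub>R \<epsilon> i + b *\<^sub>R \<epsilon> j + of_int r *\<^sub>R \<delta> \<notin> \<Psi>" for r :: int
    using \<alpha>\<beta>(3) ai(3) bj(3) unfolding gradient_def by auto
  obtain r s :: int where "\<alpha> + of_int r *\<^sub>R \<delta> \<in> \<Psi>" "\<beta> + of_int s *\<^sub>R \<delta> \<in> \<Psi>"
    using \<alpha>\<beta>(1,2) unfolding gradient_def by blast
  then have par: "has_parity (even r) i" "has_parity (even s) j"
    using has_parityI ai bj by auto
  define I where "I = {k \<in> {1..n}. \<not> has_parity False k}"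
  have "\<Psi> \<subseteq> Psi_D n \<epsilon> \<delta> I"
    unfolding I_def
    using subset_Psi_D parity_unique[OF ai(2) bj(2) \<open>i \<noteq> j\<close> par ai(1) bj(1) unlinked] by blast
  moreover have "I \<subset> {1..n}"
  proof -
    have "\<not> (has_parity True i \<and> has_parity True j)"
      using equal_parity_link[of True i j a b] ai bj \<open>i \<noteq> j\<close> unlinked by blast
    then have "has_parity False i \<or> has_parity False j"
      using par by (cases "even r"; cases "even s") auto
    then show ?thesis using ai(2) bj(2) unfolding I_def by blast
  qed
  moreover have "closed_subroot_system B (affine_roots n \<epsilon> \<delta>) (Psi_D n \<epsilon> \<delta> I)"
    using Psi_D_closed_subroot_system assms(1) by simp
  ultimately show ?thesis using maximal Psi_D_proper by metis
qed

end
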